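(* Let $D\in\mathcal{S}_n^k$, let $\mathcal{T}^q_\sigma$ be as defined in the context (with common vertex set $V$), and let $h:E(D)\to\mathcal{T}^q_\sigma$ be any function. Then $D\otimes_h\mathcal{T}^q_\sigma$ is edge-magic.
   Context: Digraphs may have loops but no multiple arcs. $[a,b]=\{a,\dots,b\}$. An edge-magic labeling of a $(p,q)$-(di)graph $G$ is a bijection $f:V(G)\cup E(G)\to[1,p+q]$ with $f(x)+f(xy)+f(y)=\mathrm{val}(f)$ constant over edges (the magic sum); $G$ is edge-magic if it has one; super edge-magic if moreover $f(V(G))=[1,p]$. $\mathcal{S}_n^k$: the set of digraphs $D$ with vertex set $[1,n]$ (vertices named by their labels in a super edge-magic labeling), exactly $n$ arcs, and $\{i+j:(i,j)\in E(D)\}=[k,k+n-1]$. Fix a set $V$ of $p$ positive integers and integers $q,\sigma$. $\mathcal{T}^q_\sigma$ is a family of edge-magic labeled digraphs $F$, each with vertex set $V(F)=V$ (each vertex named by its label, so $V\subseteq[1,p+q]$), with $|E(F)|=q$ and magic sum $\sigma$. For $h:E(D)\to\mathcal{T}^q_\sigma$, the digraph $D\otimes_h\mathcal{T}^q_\sigma$ has vertex set $V(D)\times V$, and $((i,a),(j,b))$ is an arc iff $(i,j)\in E(D)$ and $(a,b)\in E(h(i,j))$. *)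

theory Defs
  imports "Graph_Theory.Pair_Digraph"
begin

text \<open>
  Finite digraphs, possibly with loops but without multiple arcs, are the
  \<^locale>\<open>pair_fin_digraph\<close>s of the Graph Theory library.  A labeling is a function on the
  disjoint union of vertices (\<^const>\<open>Inl\<close>) and arcs (\<^const>\<open>Inr\<close>).  Labels are of type
  \<^typ>\<open>int\<close>, so that no sign conditions are imposed on parameters such as the magic sum.
\<close>

definition edge_magic_labeling ::
    "'a pair_pre_digraph \<Rightarrow> ('a + 'a \<times> 'a \<Rightarrow> int) \<Rightarrow> int \<Rightarrow> bool" where
  "edge_magic_labeling G f c \<longleftrightarrow>
     pair_fin_digraph G \<and>
     bij_betw f (pverts G <+> parcs G) {1..int (card (pverts G) + card (parcs G))} \<and>
     (\<forall>(x, y) \<in> parcs G. f (Inl x) + f (Inr (x, y)) + f (Inl y) = c)"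

definition edge_magic :: "'a pair_pre_digraph \<Rightarrow> bool" where
  "edge_magic G \<longleftrightarrow> (\<exists>f c. edge_magic_labeling G f c)"

definition super_edge_magic_labeling ::
    "'a pair_pre_digraph \<Rightarrow> ('a + 'a \<times> 'a \<Rightarrow> int) \<Rightarrow> int \<Rightarrow> bool" where
  "super_edge_magic_labeling G f c \<longleftrightarrow>
     edge_magic_labeling G f c \<and> f ` Inl ` pverts G = {1..int (card (pverts G))}"

definition vertices_named_by :: "int pair_pre_digraph \<Rightarrow> (int + int \<times> int \<Rightarrow> int) \<Rightarrow> bool" where
  "vertices_named_by G f \<longleftrightarrow> (\<forall>x \<in> pverts G. f (Inl x) = x)"

definition sem_digraphs :: "nat \<Rightarrow> int \<Rightarrow> int pair_pre_digraph set" where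
  "sem_digraphs n k = {D.
     pverts D = {1..int n} \<and>
     (\<exists>f c. super_edge_magic_labeling D f c \<and> vertices_named_by D f) \<and>
     card (parcs D) = n \<and>
     {i + j | i j. (i, j) \<in> parcs D} = {k..k + int n - 1}}"

text \<open>
  A family of edge-magic labeled digraphs on the common vertex set \<open>V\<close> with \<open>q\<close> arcs and
  magic sum \<open>\<sigma>\<close>; it need not contain all such digraphs.  The labeling need not be
  stored with the digraph: vertices are their own labels, and the label of an arc
  \<open>(x, y)\<close> is then necessarily \<open>\<sigma> - x - y\<close>.
\<close>

definition edge_magic_family ::
    "int set \<Rightarrow> nat \<Rightarrow> int \<Rightarrow> int pair_pre_digraph set \<Rightarrow> bool" where
  "edge_magic_family V q \<sigma> T \<longleftrightarrow>
     (\<forall>F \<in> T. pverts F = V \<and> card (parcs F) = q \<and>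
        (\<exists>f. edge_magic_labeling F f \<sigma> \<and> vertices_named_by F f))"

text \<open>
  The common vertex set \<open>V\<close> is an explicit argument, since it cannot be recovered from
  \<open>h\<close> when \<open>D\<close> has no arcs.
\<close>

definition otimes_h ::
    "'a pair_pre_digraph \<Rightarrow> 'b set \<Rightarrow> ('a \<times> 'a \<Rightarrow> 'b pair_pre_digraph) \<Rightarrow>
     ('a \<times> 'b) pair_pre_digraph" where
  "otimes_h D V h =
     \<lparr> pverts = pverts D \<times> V,
       parcs = {((i, a), (j, b)) | i a j b. (i, j) \<in> parcs D \<and> (a, b) \<in> parcs (h (i, j))} \<rparr>"

end

theory Submission
  imports Defs
begin

text \<open>
  Write \<open>N = [1, p + q]\<close>.  The vertex \<open>(i, a)\<close> is sent to the pair \<open>(a, i)\<close> and the arc from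
  \<open>(i, a)\<close> to \<open>(j, b)\<close> to the pair \<open>(\<sigma> - a - b, k + n - i - j)\<close>, whose first component is the label
  of the arc \<open>(a, b)\<close> in \<open>h (i, j)\<close>.  Since the sums \<open>i + j\<close> run through \<open>[k, k + n - 1]\<close> exactly once,
  the vertices fill \<open>V \<times> [1, n]\<close> and the arcs fill \<open>(N - V) \<times> [1, n]\<close>.  Composing with the bijection
  \<open>(x, r) \<mapsto> n (x - 1) + r\<close> from \<open>N \<times> [1, n]\<close> to \<open>[1, n (p + q)]\<close> gives an edge-magic labeling with
  magic sum \<open>n (\<sigma> - 3) + k + n\<close>.
\<close>

text \<open>Division of \<open>y - 1\<close> by \<open>n\<close> with remainder, each digit shifted
  by one because both ranges start at 1. For \<open>n = 0\<close> both sides are empty.\<close>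

lemma bij_betw_mult_add_atLeastAtMost:
  fixes m n :: int
  assumes "0 \<le> n"
  shows "bij_betw (\<lambda>(x, r). n * (x - 1) + r) ({1..m} \<times> {1..n}) {1..n * m}"
proof (rule bij_betwI[where g = "\<lambda>y. ((y - 1) div n + 1, (y - 1) mod n + 1)"])
  show "(\<lambda>(x, r). n * (x - 1) + r) \<in> {1..m} \<times> {1..n} \<rightarrow> {1..n * m}"
  proof clarsimp
    fix x r :: int
    assume A: "1 \<le> x" "x \<le> m" "1 \<le> r" "r \<le> n"
    have "n * 1 \<le> n * x" "n * x \<le> n * m"
      using A by (auto intro!: mult_left_mono)
    then show "1 \<le> n * (x - 1) + r \<and> n * (x - 1) + r \<le> n * m"
      using A right_diff_distrib[of n x 1] by linarith
  qed
  show "(\<lambda>y. ((y - 1) div n + 1, (y - 1) mod n + 1)) \<in> {1..n * m} \<rightarrow> {1..m} \<times> {1..n}"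
  proof
    fix y assume "y \<in> {1..n * m}"
    then have y: "0 \<le> y - 1" "y - 1 < n * m" by auto
    \<comment> \<open>\<open>n = 0\<close> would turn the two bounds on \<open>y - 1\<close> into
      \<open>0 < 0\<close>.\<close>
    with assms have n: "0 < n" by (cases "n = 0") auto
    have "n * ((y - 1) div n) < n * m"
      using y(2) n pos_mod_sign[OF n, of "y - 1"] mult_div_mod_eq[of n "y - 1"] by linarith
    then have "(y - 1) div n < m" using n by simp
    moreover have "0 \<le> (y - 1) div n"
      using n y(1) by (simp add: pos_imp_zdiv_nonneg_iff)
    ultimately show "((y - 1) div n + 1, (y - 1) mod n + 1) \<in> {1..m} \<times> {1..n}"
      using pos_mod_sign[OF n, of "y - 1"] pos_mod_bound[OF n, of "y - 1"] by auto
  qed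
next
  fix z assume "z \<in> {1..m} \<times> {1..n}"
  then obtain x r where z: "z = (x, r)" "1 \<le> r" "r \<le> n" by auto
  have "n * (x - 1) + r - 1 = n * (x - 1) + (r - 1)" by simp
  then have "(n * (x - 1) + r - 1) div n = x - 1" "(n * (x - 1) + r - 1) mod n = r - 1"
    using z int_div_pos_eq[of "n * (x - 1) + r - 1" n "x - 1" "r - 1"]
      int_mod_pos_eq[of "n * (x - 1) + r - 1" n "x - 1" "r - 1"] by auto
  with z show "(\<lambda>y. ((y - 1) div n + 1, (y - 1) mod n + 1)) (case z of (x, r) \<Rightarrow> n * (x - 1) + r) = z"
    by simp
next
  fix y assume "y \<in> {1..n * m}"
  show "(case ((y - 1) div n + 1, (y - 1) mod n + 1) of (x, r) \<Rightarrow> n * (x - 1) + r) = y"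
    using mult_div_mod_eq[of n "y - 1"] by simp
qed

lemma bij_betw_case_sum:
  assumes "bij_betw f A X" and "bij_betw g B Y" and "X \<inter> Y = {}"
  shows "bij_betw (case_sum f g) (A <+> B) (X \<union> Y)"
proof -
  have "bij_betw (case_sum f g) (Inl ` A) X" "bij_betw (case_sum f g) (Inr ` B) Y"
    using assms(1,2) by (auto simp: bij_betw_def inj_on_def image_image)
  then show ?thesis
    unfolding Plus_def using assms(3) by (rule bij_betw_combine)
qed

text \<open>The value of \<open>s\<close> identifies the arc \<open>(i, j)\<close>, and only then is
  it known in which digraph \<open>h (i, j)\<close> the value of \<open>u\<close> is to be inverted.
  The image is a full product because one map \<open>u\<close> and one set \<open>X\<close> serve
  all the digraphs \<open>h e\<close>.\<close>

lemma bij_betw_parcs_otimes_h: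
  assumes s: "bij_betw s (parcs D) Y"
    and u: "\<And>e. e \<in> parcs D \<Longrightarrow> bij_betw u (parcs (h e)) X"
  shows "bij_betw (\<lambda>((i, a), (j, b)). (u (a, b), s (i, j))) (parcs (otimes_h D V h)) (X \<times> Y)"
  unfolding bij_betw_def
proof
  show "inj_on (\<lambda>((i, a), (j, b)). (u (a, b), s (i, j))) (parcs (otimes_h D V h))"
  proof (rule inj_onI, clarsimp simp: otimes_h_def)
    fix i a j b i' a' j' b'
    assume D: "(i, j) \<in> parcs D" "(i', j') \<in> parcs D" and eq: "s (i, j) = s (i', j')"
      and h: "(a, b) \<in> parcs (h (i, j))" "(a', b') \<in> parcs (h (i', j'))" "u (a, b) = u (a', b')"
    have "(i, j) = (i', j')"
      using inj_onD[OF bij_betw_imp_inj_on[OF s] eq] D by simp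
    moreover from this have "(a, b) = (a', b')"
      using inj_onD[OF bij_betw_imp_inj_on[OF u[OF D(1)]] h(3)] h by simp
    ultimately show "i = i' \<and> a = a' \<and> j = j' \<and> b = b'" by simp
  qed
  show "(\<lambda>((i, a), (j, b)). (u (a, b), s (i, j))) ` parcs (otimes_h D V h) = X \<times> Y"
  proof (intro equalityI subsetI)
    fix z assume "z \<in> (\<lambda>((i, a), (j, b)). (u (a, b), s (i, j))) ` parcs (otimes_h D V h)"
    then show "z \<in> X \<times> Y"
      using bij_betwE[OF s] bij_betwE[OF u] by (auto simp: otimes_h_def)
  next
    fix z assume "z \<in> X \<times> Y"
    then obtain x y where z: "z = (x, y)" "x \<in> X" "y \<in> Y" by auto
    from z(3) s obtain i j where ij: "(i, j) \<in> parcs D" "y = s (i, j)"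
      by (auto simp: bij_betw_def)
    from z(2) u[OF ij(1)] obtain a b where "(a, b) \<in> parcs (h (i, j))" "x = u (a, b)"
      by (auto simp: bij_betw_def)
    with z ij show "z \<in> (\<lambda>((i, a), (j, b)). (u (a, b), s (i, j))) ` parcs (otimes_h D V h)"
      by (intro image_eqI[where x = "((i, a), (j, b))"]) (auto simp: otimes_h_def)
  qed
qed

text \<open>Vertices that are their own labels leave exactly the complement of the vertex set to the
  arcs, and the magic sum then dictates each arc label. The resulting formula depends on \<sigma>
  alone, so it is common to a whole family with that magic sum.\<close>

lemma edge_magic_labeling_vertices_named_by:
  assumes f: "edge_magic_labeling F f \<sigma>" and v: "vertices_named_by F f"
  shows "pverts F \<subseteq> {1..int (card (pverts F) + card (parcs F))}"
    and "bij_betw (\<lambda>(a, b). \<sigma> - a - b) (parcs F)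
      ({1..int (card (pverts F) + card (parcs F))} - pverts F)"
proof -
  let ?N = "{1..int (card (pverts F) + card (parcs F))}"
  have bij: "bij_betw f (pverts F <+> parcs F) ?N"
    using f by (simp add: edge_magic_labeling_def)
  have verts: "f ` Inl ` pverts F = pverts F"
    using v by (auto simp: vertices_named_by_def image_image)
  show "pverts F \<subseteq> ?N"
    using bij_betw_imp_surj_on[OF bij] verts unfolding Plus_def image_Un by blast
  have "f ` Inr ` parcs F = f ` ((pverts F <+> parcs F) - Inl ` pverts F)"
    by (rule arg_cong[where f = "image f"]) auto
  also have "\<dots> = ?N - pverts F"
    using bij verts inj_on_image_set_diff[of f "pverts F <+> parcs F"]
    by (auto simp: bij_betw_def Plus_def)
  finally have "bij_betw (f \<circ> Inr) (parcs F) (?N - pverts F)"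
    using bij by (auto simp: bij_betw_def inj_on_def image_image)
  moreover have "(f \<circ> Inr) e = (\<lambda>(a, b). \<sigma> - a - b) e" if "e \<in> parcs F" for e
  proof -
    obtain a b where e: "e = (a, b)" by fastforce
    \<comment> \<open>Well-formedness puts both endpoints of an arc among the vertices, where
      \<open>f\<close> returns the vertex itself.\<close>
    have "pair_fin_digraph F" using f by (simp add: edge_magic_labeling_def)
    then interpret pair_fin_digraph F .
    have "f (Inl a) = a" "f (Inl b) = b"
      using v that e in_arcsD1[of a b] in_arcsD2[of a b] by (auto simp: vertices_named_by_def)
    then show ?thesis
      using f that e by (auto simp: edge_magic_labeling_def)
  qed
  ultimately show "bij_betw (\<lambda>(a, b). \<sigma> - a - b) (parcs F) (?N - pverts F)"
    by (simp cong: bij_betw_cong)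
qed

text \<open>There are \<open>n\<close> arcs and their sums fill an interval of size
  \<open>n\<close>, so no sum repeats. The reflection \<open>t \<mapsto> k + n - t\<close> carries
  this interval onto \<open>[1, n]\<close>; its minus sign later cancels the contribution
  \<open>i + j\<close> of the endpoints.\<close>

lemma sem_digraphs_bij_betw:
  assumes "D \<in> sem_digraphs n k"
  shows "bij_betw (\<lambda>(i, j). k + int n - i - j) (parcs D) {1..int n}"
proof -
  let ?s = "\<lambda>(i, j). i + j :: int"
  have "?s ` parcs D = {i + j | i j. (i, j) \<in> parcs D}"
    by force
  then have img: "?s ` parcs D = {k..k + int n - 1}"
    using assms by (simp add: sem_digraphs_def)
  have "card (parcs D) = n" and fin: "finite (parcs D)"
    using assms by (auto simp: sem_digraphs_def edge_magic_labeling_def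
        super_edge_magic_labeling_def pair_fin_digraph.pair_finite_arcs)
  then have "inj_on ?s (parcs D)"
    using img by (intro eq_card_imp_inj_on) auto
  with img have "bij_betw ?s (parcs D) {k..k + int n - 1}"
    by (simp add: bij_betw_def)
  moreover have "bij_betw (\<lambda>t. k + int n - t) {k..k + int n - 1} {1..int n}"
    by (rule bij_betwI[where g = "\<lambda>t. k + int n - t"]) auto
  ultimately have "bij_betw ((\<lambda>t. k + int n - t) \<circ> ?s) (parcs D) {1..int n}"
    by (rule bij_betw_trans)
  moreover have "(\<lambda>t. k + int n - t) \<circ> ?s = (\<lambda>(i, j). k + int n - i - j)"
    by (auto simp: fun_eq_iff)
  ultimately show ?thesis by simp
qed

lemma pair_fin_digraph_otimes_h:
  assumes D: "pair_fin_digraph D" and "finite V"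
    and h: "\<And>e. e \<in> parcs D \<Longrightarrow> pair_fin_digraph (h e) \<and> pverts (h e) = V"
  shows "pair_fin_digraph (otimes_h D V h)"
proof -
  interpret pair_fin_digraph D by (rule D)
  \<comment> \<open>This inclusion yields both the finiteness of the arc set and the well-formedness
    of the arcs.\<close>
  have sub: "parcs (otimes_h D V h) \<subseteq> (pverts D \<times> V) \<times> (pverts D \<times> V)"
  proof (clarsimp simp: otimes_h_def)
    fix i a j b assume e: "(i, j) \<in> parcs D" "(a, b) \<in> parcs (h (i, j))"
    then interpret H: pair_fin_digraph "h (i, j)" using h by blast
    show "i \<in> pverts D \<and> a \<in> V \<and> j \<in> pverts D \<and> b \<in> V"
      using e h in_arcsD1 in_arcsD2 H.in_arcsD1 H.in_arcsD2 by blast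
  qed
  have fin: "finite (pverts (otimes_h D V h))"
    using \<open>finite V\<close> by (simp add: otimes_h_def)
  moreover have "finite (parcs (otimes_h D V h))"
    using sub by (rule finite_subset) (simp add: \<open>finite V\<close>)
  moreover have "pverts (otimes_h D V h) = pverts D \<times> V"
    by (simp add: otimes_h_def)
  ultimately show ?thesis
    using sub by unfold_locales auto
qed

theorem theorem3p1:
  fixes n p q :: nat and k \<sigma> :: int
    and V :: "int set"
    and D :: "int pair_pre_digraph"
    and T :: "int pair_pre_digraph set"
    and h :: "int \<times> int \<Rightarrow> int pair_pre_digraph"
  assumes "D \<in> sem_digraphs n k"
    and "finite V" and "card V = p" and "\<forall>a \<in> V. 0 < a"
    and "edge_magic_family V q \<sigma> T"
    and "\<forall>e \<in> parcs D. h e \<in> T"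
  shows "edge_magic (otimes_h D V h)"
proof -
  let ?G = "otimes_h D V h" and ?N = "{1..int (p + q)}"
  let ?s = "\<lambda>(i, j). k + int n - i - j" and ?u = "\<lambda>(a, b). \<sigma> - a - b"
  let ?w = "\<lambda>((i, a), (j, b)). (?u (a, b), ?s (i, j))"
  let ?m = "case_sum prod.swap ?w"
  let ?g = "\<lambda>(x, r). int n * (x - 1) + r"
  have D: "pair_fin_digraph D" "pverts D = {1..int n}" "card (parcs D) = n"
    using assms(1)
    by (auto simp: sem_digraphs_def super_edge_magic_labeling_def edge_magic_labeling_def)
  have s: "bij_betw ?s (parcs D) {1..int n}"
    by (rule sem_digraphs_bij_betw[OF assms(1)])
  have h: "pair_fin_digraph (h e) \<and> pverts (h e) = V \<and> V \<subseteq> ?N \<and> bij_betw ?u (parcs (h e)) (?N - V)"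
    if "e \<in> parcs D" for e
  proof -
    have "h e \<in> T" using assms(6) that by blast
    then obtain f where "pverts (h e) = V" "card (parcs (h e)) = q"
      "edge_magic_labeling (h e) f \<sigma>" "vertices_named_by (h e) f"
      using assms(5) by (auto simp: edge_magic_family_def)
    then show ?thesis
      using edge_magic_labeling_vertices_named_by[of "h e" f \<sigma>] assms(3)
      by (auto simp: edge_magic_labeling_def)
  qed
  have fin: "pair_fin_digraph ?G"
    using D(1) assms(2) h by (intro pair_fin_digraph_otimes_h) auto
  \<comment> \<open>\<open>V \<subseteq> ?N\<close> is obtained from \<open>h e\<close> for some arc
    \<open>e\<close>. For \<open>n = 0\<close> there is no arc, but then both sides are
    empty.\<close>
  have V: "V \<times> {1..int n} \<union> (?N - V) \<times> {1..int n} = ?N \<times> {1..int n}"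
  proof (cases "n = 0")
    case False
    with D(3) obtain e where "e \<in> parcs D" by (metis card.empty ex_in_conv)
    with h show ?thesis by blast
  qed simp
  have "bij_betw prod.swap (pverts ?G) (V \<times> {1..int n})"
    by (rule bij_betwI[where g = prod.swap]) (auto simp: otimes_h_def D(2))
  moreover have "bij_betw ?w (parcs ?G) ((?N - V) \<times> {1..int n})"
    using s h by (intro bij_betw_parcs_otimes_h) auto
  ultimately have "bij_betw ?m (pverts ?G <+> parcs ?G) (?N \<times> {1..int n})"
    unfolding V[symmetric] by (rule bij_betw_case_sum) auto
  then have bij: "bij_betw (?g \<circ> ?m) (pverts ?G <+> parcs ?G) {1..int n * int (p + q)}"
    by (rule bij_betw_trans) (rule bij_betw_mult_add_atLeastAtMost, simp)
  have "finite (pverts ?G)" "finite (parcs ?G)"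
    using fin by (auto intro: pair_fin_digraph.pair_finite_verts pair_fin_digraph.pair_finite_arcs)
  \<comment> \<open>The size of the product digraph is read off from the bijection instead of being
    counted.\<close>
  then have card: "card (pverts ?G) + card (parcs ?G) = n * (p + q)"
    using bij_betw_same_card[OF bij] by (simp add: card_Plus flip: of_nat_mult of_nat_add)
  \<comment> \<open>The first components add up to
    \<open>a + (\<sigma> - a - b) + b = \<sigma>\<close>, and the three shifts by one turn this into
    \<open>n * (\<sigma> - 3)\<close>. The second components add up to
    \<open>i + (k + n - i - j) + j = k + n\<close>.\<close>
  have "\<forall>(x, y) \<in> parcs ?G. (?g \<circ> ?m) (Inl x) + (?g \<circ> ?m) (Inr (x, y)) + (?g \<circ> ?m) (Inl y) =
      int n * (\<sigma> - 3) + k + int n"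
    by (auto simp: otimes_h_def algebra_simps)
  with fin bij have "edge_magic_labeling ?G (?g \<circ> ?m) (int n * (\<sigma> - 3) + k + int n)"
    unfolding edge_magic_labeling_def card of_nat_mult by blast
  then show ?thesis
    by (auto simp: edge_magic_def)
qed

end
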